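(* Let $E$ be a nonzero real Banach space and let $S : E \rightrightarrows E^*$ be closed, quasidense and monotone. Then its Fitzpatrick extension $S^{\mathbb F} : E^* \rightrightarrows E^{**}$ is maximally monotone.
   Context: For a multifunction $S : E \rightrightarrows E^*$, $G(S) := \{(x,x^* ) : x^* \in Sx\}$ is its graph; $S$ is closed if $G(S)$ is closed in $E \times E^*$ (norm topology), monotone if $\langle s-t, s^*-t^*\rangle \ge 0$ for all $(s,s^* ),(t,t^* ) \in G(S)$, and quasidense if, for all $(x,x^* ) \in E \times E^*$, $\inf_{(s,s^* ) \in G(S)}\big[\frac12\|s-x\|^2 + \frac12\|s^*-x^*\|^2 + \langle s-x, s^*-x^*\rangle\big] \le 0$. The Fitzpatrick function of $S$ is $\varphi_S(x,x^* ) := \sup_{(s,s^* ) \in G(S)}[\langle s, x^*\rangle + \langle x, s^*\rangle - \langle s, s^*\rangle]$ on $E \times E^*$, with Fenchel conjugate ${\varphi_S}^*(y^*,y^{**}) := \sup_{(x,x^* ) \in E \times E^*}[\langle x, y^*\rangle + \langle x^*, y^{**}\rangle - \varphi_S(x,x^* )]$ on $E^* \times E^{**}$. For $S$ closed, quasidense and monotone, the Fitzpatrick extension $S^{\mathbb F} : E^* \rightrightarrows E^{**}$ is the multifunction with graph $G(S^{\mathbb F}) := \{(y^*,y^{**}) \in E^* \times E^{**} : {\varphi_S}^*(y^*,y^{**}) = \langle y^*, y^{**}\rangle\}$. Monotonicity and maximal monotonicity of a multifunction $E^* \rightrightarrows E^{**}$ are understood with respect to the pairing $\langle y^*, y^{**}\rangle$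 of $E^*$ with its dual $E^{**}$. *)

theory Defs
  imports "HOL-Analysis.Analysis"
begin

text \<open>The dual of \<open>E\<close> is the type \<open>E \<Rightarrow>\<^sub>L real\<close> of bounded linear functionals with the operator norm,
  and the bidual is \<open>(E \<Rightarrow>\<^sub>L real) \<Rightarrow>\<^sub>L real\<close>.
  The definitions for multifunctions from \<open>E\<close> to its dual are polymorphic in \<open>E\<close>, 
  hence also apply to multifunctions from the dual to the bidual.\<close>

type_synonym 'a dual = "'a \<Rightarrow>\<^sub>L real"

abbreviation pairing :: "'a::real_normed_vector \<Rightarrow> 'a dual \<Rightarrow> real" where
  "pairing x x' \<equiv> blinfun_apply x' x"

definition mf_graph :: "('a \<Rightarrow> 'b set) \<Rightarrow> ('a \<times> 'b) set" where
  "mf_graph S = {(x, y). y \<in> S x}"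

text \<open>The library norm on a product is the Euclidean one; it induces the product of the norm topologies.\<close>

definition closed_mf :: "('a::real_normed_vector \<Rightarrow> 'a dual set) \<Rightarrow> bool" where
  "closed_mf S \<longleftrightarrow> closed (mf_graph S)"

definition monotone_mf :: "('a::real_normed_vector \<Rightarrow> 'a dual set) \<Rightarrow> bool" where
  "monotone_mf S \<longleftrightarrow>
    (\<forall>(s, s') \<in> mf_graph S. \<forall>(t, t') \<in> mf_graph S. pairing (s - t) (s' - t') \<ge> 0)"

definition maximally_monotone_mf :: "('a::real_normed_vector \<Rightarrow> 'a dual set) \<Rightarrow> bool" where
  "maximally_monotone_mf S \<longleftrightarrow>
    monotone_mf S \<and> (\<forall>T. monotone_mf T \<and> mf_graph S \<subseteq> mf_graph T \<longrightarrow> mf_graph T = mf_graph S)"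

text \<open>The infimum is taken in \<open>ereal\<close>, so that the infimum over an empty graph is \<open>\<infinity>\<close>.\<close>

definition quasidense :: "('a::real_normed_vector \<Rightarrow> 'a dual set) \<Rightarrow> bool" where
  "quasidense S \<longleftrightarrow>
    (\<forall>x x'. (INF (s, s') \<in> mf_graph S.
        ereal (1/2 * (norm (s - x))\<^sup>2 + 1/2 * (norm (s' - x'))\<^sup>2 + pairing (s - x) (s' - x'))) \<le> 0)"

definition fitzpatrick :: "('a::real_normed_vector \<Rightarrow> 'a dual set) \<Rightarrow> 'a \<times> 'a dual \<Rightarrow> ereal" where
  "fitzpatrick S = (\<lambda>(x, x'). SUP (s, s') \<in> mf_graph S.
      ereal (pairing s x' + pairing x s' - pairing s s'))"

text \<open>Fenchel conjugate of a function on \<open>E \<times> E*\<close>, the dual of \<open>E \<times> E*\<close> being identified with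
  \<open>E* \<times> E**\<close>. The minuend is finite, so the \<open>ereal\<close> subtraction is never of the form
  \<open>\<infinity> - \<infinity>\<close>.\<close>

definition fenchel_conjugate ::
    "('a::real_normed_vector \<times> 'a dual \<Rightarrow> ereal) \<Rightarrow> 'a dual \<times> 'a dual dual \<Rightarrow> ereal" where
  "fenchel_conjugate f = (\<lambda>(y', y''). SUP (x, x') \<in> UNIV.
      ereal (pairing x y' + pairing x' y'') - f (x, x'))"

definition fitzpatrick_extension ::
    "('a::real_normed_vector \<Rightarrow> 'a dual set) \<Rightarrow> 'a dual \<Rightarrow> 'a dual dual set" where
  "fitzpatrick_extension S y' =
    {y''. fenchel_conjugate (fitzpatrick S) (y', y'') = ereal (pairing y' y'')}"

end

theory Submission
  imports Defs
begin

text \<open>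
  Embed \<open>E \<times> E*\<close> in \<open>E* \<times> E**\<close> by \<open>L (s, s') = (s', s)\<close>, with \<open>s\<close> regarded as an element of the
  bidual, and let \<open>q (y', y'') = \<langle>y', y''\<rangle>\<close>. The proof rests on the values
  \<open>q (L (s, s') - (y', y''))\<close> for \<open>(s, s')\<close> in the graph of \<open>S\<close>, called \<open>bidual_gap\<close> below; a point
  \<open>c = (y', y'')\<close> is monotonically related to \<open>L (G(S))\<close> iff all of them are nonnegative.

  Quasidensity makes the infimum of the gaps at most \<open>0\<close> at \<^emph>\<open>every\<close> point of \<open>E* \<times> E**\<close>
  (\<open>quasidense_bidual_gap_small\<close>). This one property is used in three ways.

  \<^item> The points monotonically related to \<open>L (G(S))\<close> are monotonically related to one another: at the
    midpoint of two such points the gap is the mean of two nonnegative gaps minus a quarter of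
    \<open>q (c - d)\<close>, so \<open>q (c - d) < 0\<close> would bound all gaps at the midpoint away from \<open>0\<close>.

  \<^item> The conjugate of the Fitzpatrick function is everywhere at least \<open>q\<close>, because at \<open>c\<close> it dominates
    \<open>q c\<close> minus each gap.

  \<^item> At a point \<open>c\<close> monotonically related to \<open>L (G(S))\<close> the conjugate is also at most \<open>q c\<close>. Indeed
    the function \<open>\<Theta> d = sup (q d - gap at d)\<close> is convex, lies above \<open>q\<close>, and touches \<open>q\<close> at \<open>c\<close>; so
    it lies above the linearization of \<open>q\<close> at \<open>c\<close>. Restricted to the range of \<open>L\<close>, \<open>\<Theta>\<close> is the
    Fitzpatrick function, and this inequality is the required bound on the conjugate.

  Hence the graph of the Fitzpatrick extension consists of exactly the points monotonically related to
  \<open>L (G(S))\<close>. This set contains \<open>L (G(S))\<close>, so a monotone multifunction extending it has all its points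
  monotonically related to \<open>L (G(S))\<close>, that is, already in the set.
\<close>

definition bidual_gap ::
    "'a::real_normed_vector \<Rightarrow> 'a dual \<Rightarrow> 'a dual \<Rightarrow> 'a dual dual \<Rightarrow> real" where
  "bidual_gap s s' y' y'' = pairing s (s' - y') - pairing (s' - y') y''"

definition canonical_bidual :: "'a::real_normed_vector \<Rightarrow> 'a dual dual" where
  "canonical_bidual s = Blinfun (\<lambda>f. blinfun_apply f s)"

lemma pairing_canonical_bidual [simp]: "pairing f (canonical_bidual s) = pairing s f"
  unfolding canonical_bidual_def
  by (subst bounded_linear_Blinfun_apply) (auto intro: bounded_linear_intros)

lemma bidual_gap_expand:
  "bidual_gap s s' y' y'' =
     pairing s s' - pairing s y' - pairing s' y'' + pairing y' y''"
  by (simp add: bidual_gap_def blinfun.diff_left blinfun.diff_right)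

text \<open>Vectors almost attaining the norm, scaled to the length at which Young's inequality
  \<open>f w \<le> \<parallel>w\<parallel>\<^sup>2 / 2 + \<parallel>f\<parallel>\<^sup>2 / 2\<close> is nearly an equality.\<close>

lemma young_nearly_attained:
  fixes f :: "'b::real_normed_vector dual"
  assumes "e > 0"
  obtains w where "1/2 * (norm w)\<^sup>2 + 1/2 * (norm f)\<^sup>2 - pairing w f < e"
proof (cases "norm f = 0")
  case True
  then show ?thesis
    using that[of 0] assms by simp
next
  case False
  then have pos: "norm f > 0" by simp
  define b where "b = max 0 (norm f - e / (2 * norm f))"
  have b: "b \<ge> 0" "b < norm f" "b \<ge> norm f - e / (2 * norm f)"
    using pos assms by (auto simp: b_def)
  obtain x where x: "norm (blinfun_apply f x) > b * norm x"
    using norm_blinfun_bound[of b f] b by (meson not_le)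
  have x0: "norm x > 0"
    using x by (cases "x = 0") auto
  define w where "w = (sgn (f x) * norm f / norm x) *\<^sub>R x"
  have fx0: "f x \<noteq> 0"
    using x b x0 by (metis mult_nonneg_nonneg norm_zero norm_ge_zero not_le)
  have nw: "norm w = norm f"
    using x0 fx0 by (simp add: w_def abs_mult abs_sgn_eq)
  have "f w = norm f * (\<bar>f x\<bar> / norm x)"
    by (simp add: w_def blinfun.scaleR_right abs_sgn mult_ac)
  also have "\<dots> \<ge> norm f * b"
    using x x0 pos by (intro mult_left_mono) (auto simp: field_simps)
  finally have "f w \<ge> norm f * b" .
  moreover have "norm f * b \<ge> norm f * (norm f - e / (2 * norm f))"
    using b pos by (intro mult_left_mono) auto
  moreover have "norm f * (norm f - e / (2 * norm f)) = (norm f)\<^sup>2 - e / 2"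
    using pos by (simp add: field_simps power2_eq_square)
  ultimately have "f w \<ge> (norm f)\<^sup>2 - e / 2" by linarith
  then show ?thesis
    using that[of w] nw assms by simp
qed

text \<open>Apply quasidensity at \<open>(0, y' + w)\<close>, where \<open>w\<close> is nearly a dual vector of \<open>y''\<close>. The two squared
  norms from quasidensity absorb the cross terms \<open>\<langle>s, w\<rangle>\<close> and \<open>\<langle>s' - y' - w, y''\<rangle>\<close>, leaving
  \<open>\<parallel>w\<parallel>\<^sup>2 / 2 + \<parallel>y''\<parallel>\<^sup>2 / 2 - \<langle>w, y''\<rangle>\<close>, which is small by the choice of \<open>w\<close>.\<close>

lemma quasidense_bidual_gap_small:
  fixes S :: "'a::real_normed_vector \<Rightarrow> 'a dual set"
  assumes "quasidense S" and "e > 0"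
  obtains s s' where "(s, s') \<in> mf_graph S" and "bidual_gap s s' y' y'' < e"
proof -
  obtain w where w: "1/2 * (norm w)\<^sup>2 + 1/2 * (norm y'')\<^sup>2 - pairing w y'' < e / 2"
    using young_nearly_attained[of "e / 2" y''] assms(2) by auto
  have "(INF (s, s') \<in> mf_graph S.
      ereal (1/2 * (norm (s - 0))\<^sup>2 + 1/2 * (norm (s' - (y' + w)))\<^sup>2 + pairing (s - 0) (s' - (y' + w)))) \<le> 0"
    using assms(1) unfolding quasidense_def by blast
  also have "(0::ereal) < ereal (e / 2)" using assms(2) by simp
  finally obtain s s' where s: "(s, s') \<in> mf_graph S"
    and less: "1/2 * (norm s)\<^sup>2 + 1/2 * (norm (s' - (y' + w)))\<^sup>2 + pairing s (s' - (y' + w)) < e / 2"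
    unfolding INF_less_iff by auto
  define v where "v = s' - (y' + w)"
  have young: "a * b \<le> 1/2 * a\<^sup>2 + 1/2 * b\<^sup>2" for a b :: real
    using sum_squares_bound[of a b] by simp
  have "pairing s w \<le> norm w * norm s"
    using norm_blinfun[of w s] by simp
  then have 1: "pairing s w \<le> 1/2 * (norm w)\<^sup>2 + 1/2 * (norm s)\<^sup>2"
    using young[of "norm w" "norm s"] by linarith
  have "- pairing v y'' \<le> norm y'' * norm v"
    using norm_blinfun[of y'' v] by simp
  then have 2: "- pairing v y'' \<le> 1/2 * (norm y'')\<^sup>2 + 1/2 * (norm v)\<^sup>2"
    using young[of "norm y''" "norm v"] by linarith
  have "s' - y' = v + w" by (simp add: v_def)
  then have "bidual_gap s s' y' y'' = pairing s v + pairing s w - pairing v y'' - pairing w y''"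
    by (simp add: bidual_gap_def blinfun.add_left blinfun.add_right)
  also have "\<dots> < e"
    using 1 2 w less unfolding v_def[symmetric] by linarith
  finally show ?thesis using that s by blast
qed

text \<open>Were \<open>q (c - d)\<close> negative, then \<open>- q (c - d) / 4\<close> would be a positive lower bound for the gaps at
  the midpoint of \<open>c\<close> and \<open>d\<close>.\<close>

lemma quasidense_related_points_related:
  fixes S :: "'a::real_normed_vector \<Rightarrow> 'a dual set"
  assumes qd: "quasidense S"
    and y: "\<And>s s'. (s, s') \<in> mf_graph S \<Longrightarrow> bidual_gap s s' y' y'' \<ge> 0"
    and z: "\<And>s s'. (s, s') \<in> mf_graph S \<Longrightarrow> bidual_gap s s' z' z'' \<ge> 0"
  shows "pairing (y' - z') (y'' - z'') \<ge> 0"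
proof (rule ccontr)
  define Q where "Q = pairing (y' - z') (y'' - z'')"
  assume "\<not> ?thesis"
  then have "- Q / 4 > 0" by (simp add: Q_def)
  then obtain s s' where s: "(s, s') \<in> mf_graph S"
    and less: "bidual_gap s s' ((1/2) *\<^sub>R (y' + z')) ((1/2) *\<^sub>R (y'' + z'')) < - Q / 4"
    using quasidense_bidual_gap_small[OF qd] by blast
  have "bidual_gap s s' ((1/2) *\<^sub>R (y' + z')) ((1/2) *\<^sub>R (y'' + z'')) =
      1/2 * bidual_gap s s' y' y'' + 1/2 * bidual_gap s s' z' z'' - 1/4 * Q"
    by (simp add: bidual_gap_expand Q_def blinfun.bilinear_simps field_simps)
  then show False
    using less y[OF s] z[OF s] by linarith
qed

text \<open>The right-hand side is the value at \<open>L (x, x')\<close> of the linearization of \<open>q\<close> at \<open>c = (y', y'')\<close>.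
  Take a graph point whose gap at \<open>c + t (L (x, x') - c)\<close> is less than a small multiple of \<open>t\<close>. That
  gap is a quadratic polynomial \<open>g - t B + t\<^sup>2 Q\<close>, where \<open>g \<ge> 0\<close> is the gap at \<open>c\<close>; dividing by \<open>t\<close> and
  using \<open>g / t \<ge> g\<close> shows that \<open>B - g\<close> is nonnegative up to a small error. But \<open>B - g\<close> is exactly the
  amount by which the term of this graph point in the Fitzpatrick supremum exceeds the linearization.\<close>

lemma fitzpatrick_ge_at_related:
  fixes S :: "'a::real_normed_vector \<Rightarrow> 'a dual set"
  assumes qd: "quasidense S"
    and y: "\<And>s s'. (s, s') \<in> mf_graph S \<Longrightarrow> bidual_gap s s' y' y'' \<ge> 0"
  shows "fitzpatrick S (x, x') \<ge> ereal (pairing x y' + pairing x' y'' - pairing y' y'')"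
proof (rule ereal_le_epsilon2)
  fix e :: real
  assume e: "0 < e"
  \<comment> \<open>\<open>Q\<close> is \<open>q (L (x, x') - c)\<close>, and \<open>t\<close> is chosen so that \<open>t * \<bar>Q\<bar> \<le> e / 2\<close>.\<close>
  define Q where "Q = bidual_gap x x' y' y''"
  define t where "t = min 1 (e / (2 * (\<bar>Q\<bar> + 1)))"
  have t: "0 < t" "t \<le> 1" using e by (auto simp: t_def)
  have "t * \<bar>Q\<bar> \<le> e / (2 * (\<bar>Q\<bar> + 1)) * \<bar>Q\<bar>"
    by (intro mult_right_mono) (auto simp: t_def)
  also have "\<dots> \<le> e / 2"
    using e by (simp add: field_simps)
  finally have tQ: "t * \<bar>Q\<bar> \<le> e / 2" .
  have "t * (e / 2) > 0" using t e by simp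
  then obtain s s' where s: "(s, s') \<in> mf_graph S"
    and less: "bidual_gap s s' (y' + t *\<^sub>R (x' - y')) (y'' + t *\<^sub>R (canonical_bidual x - y'')) < t * (e / 2)"
    using quasidense_bidual_gap_small[OF qd] by blast
  define g where "g = bidual_gap s s' y' y''"
  have g: "g \<ge> 0" using y[OF s] by (simp add: g_def)
  define B where "B = pairing s x' + pairing x s' - pairing s y' - pairing s' y''
    - pairing x y' - pairing x' y'' + 2 * pairing y' y''"
  have "bidual_gap s s' (y' + t *\<^sub>R (x' - y')) (y'' + t *\<^sub>R (canonical_bidual x - y'')) =
      g - t * B + t * (t * Q)"
    unfolding bidual_gap_expand g_def B_def Q_def
    by (simp add: blinfun.bilinear_simps algebra_simps)
  moreover have "t * g \<le> g" using t g by (simp add: mult_left_le_one_le)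
  ultimately have "t * (g - B + t * Q) < t * (e / 2)"
    using less by (simp add: algebra_simps)
  then have "g - B + t * Q < e / 2" using t by simp
  moreover have "- (t * Q) \<le> t * \<bar>Q\<bar>"
    using t by (metis abs_ge_minus_self abs_mult abs_of_pos)
  ultimately have "B - g \<ge> - e" using tQ by linarith
  moreover have "pairing s x' + pairing x s' - pairing s s' =
      B - g + (pairing x y' + pairing x' y'' - pairing y' y'')"
    by (simp add: B_def g_def bidual_gap_expand)
  ultimately have "pairing x y' + pairing x' y'' - pairing y' y''
      \<le> pairing s x' + pairing x s' - pairing s s' + e"
    by linarith
  then have "ereal (pairing x y' + pairing x' y'' - pairing y' y'')
      \<le> ereal (pairing s x' + pairing x s' - pairing s s') + ereal e"
    by simp
  also have "ereal (pairing s x' + pairing x s' - pairing s s') \<le> fitzpatrick S (x, x')"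
    unfolding fitzpatrick_def using s by (auto intro!: SUP_upper2[of "(s, s')"])
  then have "ereal (pairing s x' + pairing x s' - pairing s s') + ereal e
      \<le> fitzpatrick S (x, x') + ereal e"
    by (rule add_right_mono)
  finally show "ereal (pairing x y' + pairing x' y'' - pairing y' y'')
      \<le> fitzpatrick S (x, x') + ereal e" .
qed

text \<open>Monotonicity gives \<open>\<phi>\<^sub>S (s, s') \<le> \<langle>s, s'\<rangle>\<close> on the graph, so evaluating the supremum that defines the
  conjugate at graph points bounds it below by \<open>\<langle>s, y'\<rangle> + \<langle>s', y''\<rangle> - \<langle>s, s'\<rangle>\<close>, which is \<open>q\<close> minus the gap.\<close>

lemma fenchel_conjugate_fitzpatrick_ge:
  fixes S :: "'a::real_normed_vector \<Rightarrow> 'a dual set"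
  assumes mono: "monotone_mf S" and s: "(s, s') \<in> mf_graph S"
  shows "fenchel_conjugate (fitzpatrick S) (y', y'') \<ge> ereal (pairing y' y'' - bidual_gap s s' y' y'')"
proof -
  have "fitzpatrick S (s, s') \<le> ereal (pairing s s')"
    unfolding fitzpatrick_def prod.case
  proof (rule SUP_least)
    fix p assume "p \<in> mf_graph S"
    then obtain t t' where p: "p = (t, t')" and t: "(t, t') \<in> mf_graph S" by (cases p) auto
    have "pairing (s - t) (s' - t') \<ge> 0"
      using mono s t unfolding monotone_mf_def by fast
    then show "(case p of (t, t') \<Rightarrow> ereal (pairing t s' + pairing s t' - pairing t t'))
        \<le> ereal (pairing s s')"
      by (simp add: p blinfun.bilinear_simps)
  qed
  then have "ereal (pairing s y' + pairing s' y'') - ereal (pairing s s')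
      \<le> ereal (pairing s y' + pairing s' y'') - fitzpatrick S (s, s')"
    by (intro ereal_minus_mono) auto
  also have "\<dots> \<le> fenchel_conjugate (fitzpatrick S) (y', y'')"
    unfolding fenchel_conjugate_def by (auto intro!: SUP_upper2[of "(s, s')"])
  finally show ?thesis by (simp add: bidual_gap_expand)
qed

text \<open>From left to right, the gaps are nonnegative since the conjugate dominates \<open>q\<close> minus each of
  them. Conversely, nonnegative gaps let the conjugate be bounded above through the linearization of
  \<open>q\<close>, and small gaps bound it below.\<close>

lemma mem_fitzpatrick_extension_iff:
  fixes S :: "'a::real_normed_vector \<Rightarrow> 'a dual set"
  assumes qd: "quasidense S" and mono: "monotone_mf S"
  shows "(y', y'') \<in> mf_graph (fitzpatrick_extension S) \<longleftrightarrow>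
    (\<forall>(s, s') \<in> mf_graph S. bidual_gap s s' y' y'' \<ge> 0)"
proof -
  let ?C = "fenchel_conjugate (fitzpatrick S) (y', y'')"
  have "?C = ereal (pairing y' y'') \<longleftrightarrow> (\<forall>(s, s') \<in> mf_graph S. bidual_gap s s' y' y'' \<ge> 0)"
  proof
    assume eq: "?C = ereal (pairing y' y'')"
    show "\<forall>(s, s') \<in> mf_graph S. bidual_gap s s' y' y'' \<ge> 0"
      using fenchel_conjugate_fitzpatrick_ge[OF mono, where y' = y' and y'' = y''] unfolding eq by fastforce
  next
    assume "\<forall>(s, s') \<in> mf_graph S. bidual_gap s s' y' y'' \<ge> 0"
    then have rel: "\<And>s s'. (s, s') \<in> mf_graph S \<Longrightarrow> bidual_gap s s' y' y'' \<ge> 0" by auto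
    show "?C = ereal (pairing y' y'')"
    proof (rule antisym)
      have "ereal (pairing x y' + pairing x' y'') - fitzpatrick S (x, x') \<le> ereal (pairing y' y'')"
        for x x'
        using fitzpatrick_ge_at_related[OF qd rel, of x x']
        by (cases "fitzpatrick S (x, x')") auto
      then show "?C \<le> ereal (pairing y' y'')"
        unfolding fenchel_conjugate_def by (auto intro!: SUP_least)
      show "ereal (pairing y' y'') \<le> ?C"
      proof (rule ereal_le_epsilon2)
        fix e :: real
        assume "0 < e"
        then obtain s s' where s: "(s, s') \<in> mf_graph S" and less: "bidual_gap s s' y' y'' < e"
          using quasidense_bidual_gap_small[OF qd] by blast
        have "ereal (pairing y' y'') \<le> ereal (pairing y' y'' - bidual_gap s s' y' y'') + ereal e"
          using less by simp
        also have "\<dots> \<le> ?C + ereal e"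
          by (intro add_right_mono fenchel_conjugate_fitzpatrick_ge mono s)
        finally show "ereal (pairing y' y'') \<le> ?C + ereal e" .
      qed
    qed
  qed
  then show ?thesis
    by (simp add: mf_graph_def fitzpatrick_extension_def)
qed

theorem theorem8p2:
  fixes S :: "'a::banach \<Rightarrow> 'a dual set"
  assumes "\<exists>x::'a. x \<noteq> 0"
    and "closed_mf S"
    and "quasidense S"
    and "monotone_mf S"
  shows "maximally_monotone_mf (fitzpatrick_extension S)"
proof -
  note char = mem_fitzpatrick_extension_iff[OF assms(3,4)]
  have mono: "monotone_mf (fitzpatrick_extension S)"
    unfolding monotone_mf_def
    by (auto simp: char intro!: quasidense_related_points_related[OF assms(3)])
  have image: "(s', canonical_bidual s) \<in> mf_graph (fitzpatrick_extension S)"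
    if s: "(s, s') \<in> mf_graph S" for s s'
    unfolding char
  proof clarify
    fix t t' assume "(t, t') \<in> mf_graph S"
    then have "pairing (t - s) (t' - s') \<ge> 0"
      using s assms(4) unfolding monotone_mf_def by fast
    then show "bidual_gap t t' s' (canonical_bidual s) \<ge> 0"
      by (simp add: bidual_gap_def blinfun.diff_left blinfun.diff_right)
  qed
  have "mf_graph T \<subseteq> mf_graph (fitzpatrick_extension S)"
    if T: "monotone_mf T" and ext: "mf_graph (fitzpatrick_extension S) \<subseteq> mf_graph T" for T
  proof clarify
    fix y' y'' assume y: "(y', y'') \<in> mf_graph T"
    show "(y', y'') \<in> mf_graph (fitzpatrick_extension S)"
      unfolding char
    proof clarify
      fix s s' assume "(s, s') \<in> mf_graph S"
      then have "(s', canonical_bidual s) \<in> mf_graph T"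
        using image ext by blast
      then have "pairing (s' - y') (canonical_bidual s - y'') \<ge> 0"
        using T y unfolding monotone_mf_def by fast
      then show "bidual_gap s s' y' y'' \<ge> 0"
        by (simp add: bidual_gap_def blinfun.diff_left)
    qed
  qed
  then show ?thesis
    using mono unfolding maximally_monotone_mf_def by blast
qed

end
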